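(* Let $G$ be a threshold graph with clique number $\omega(G)$, let $\mathcal{M}_G$ be the set of maximal cliques of $G$, let $T$ be a tree, and let $\sigma:V(T)\to\mathcal{M}_G$ be a bijection. For each positive integer $j\in\{1,\ldots,\omega(G)\}$, let $\mathcal{K}_G^j=\{M\in\mathcal{M}_G:|M|\ge j\}$ and let $T_j$ denote the subgraph of $T$ induced by the nodes in $\{\sigma^{-1}(M):M\in\mathcal{K}_G^j\}$. Then $(T,\sigma)$ is a clique tree pair of $G$ if and only if for each $j\in\{1,\ldots,\omega(G)\}$, $T_j$ is a subtree of $T$, and moreover for each $j\in\{1,\ldots,\omega(G)-1\}$, $T_{j+1}$ is a subtree of $T_j$.
   Context: All graphs are finite and simple. A graph $G$ is $(K,I)$-split if $V(G)$ is partitioned into a clique $K$ and an independent set $I$ (either may be empty). A set $U\subseteq V(G)$ has the nested neighborhood property in $G$ if its vertices can be listed as $v_1,\ldots,v_{|U|}$ so that $N_G(v_i)\subseteq N_G(v_{i+1})$ for each $i\in\{1,\ldots,|U|-1\}$, where $N_G(v)$ is the set of neighbors of $v$. $G$ is a threshold graph if it is $(K,I)$-split for some $K,I$ such that $I$ has the nested neighborhood property in $G$. Maximal cliques are inclusion-maximal sets of pairwise adjacent vertices. For a chordal graph $G$ (every threshold graph is chordal), a pair $(T,\sigma)$ is a clique tree pair of $G$ if $T$ is a tree and $\sigma:V(T)\to\mathcal{M}_G$ is a bijection such that for every $v\in V(G)$, the subgraph of $T$ induced by the nodes $\{u\in V(T):v\in\sigma(u)\}$ is a subtree of $T$ (i.e.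 is connected). *)

theory Defs
  imports "Graph_Theory.Digraph_Component"
begin

text \<open>
  A finite simple graph is a digraph satisfying the library locale \<^locale>\<open>graph\<close> (finite, symmetric,
  loop-free, without parallel arcs): each undirected edge is a pair of opposite arcs. The null
  graph is admitted.
\<close>

definition neighborhood :: "('a,'b) pre_digraph \<Rightarrow> 'a \<Rightarrow> 'a set" where
  "neighborhood G v = {u \<in> verts G. v \<rightarrow>\<^bsub>G\<^esub> u}"

definition clique :: "('a,'b) pre_digraph \<Rightarrow> 'a set \<Rightarrow> bool" where
  "clique G C \<longleftrightarrow> C \<subseteq> verts G \<and> (\<forall>u\<in>C. \<forall>v\<in>C. u \<noteq> v \<longrightarrow> u \<rightarrow>\<^bsub>G\<^esub> v)"

definition independent_set :: "('a,'b) pre_digraph \<Rightarrow> 'a set \<Rightarrow> bool" where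
  "independent_set G S \<longleftrightarrow> S \<subseteq> verts G \<and> (\<forall>u\<in>S. \<forall>v\<in>S. \<not> u \<rightarrow>\<^bsub>G\<^esub> v)"

definition maximal_cliques :: "('a,'b) pre_digraph \<Rightarrow> 'a set set" where
  "maximal_cliques G = {M. clique G M \<and> (\<forall>C. clique G C \<and> M \<subseteq> C \<longrightarrow> C = M)}"

definition clique_number :: "('a,'b) pre_digraph \<Rightarrow> nat" where
  "clique_number G = Max (card ` {C. clique G C})"

definition KI_split :: "('a,'b) pre_digraph \<Rightarrow> 'a set \<Rightarrow> 'a set \<Rightarrow> bool" where
  "KI_split G K I \<longleftrightarrow>
     K \<union> I = verts G \<and> K \<inter> I = {} \<and> clique G K \<and> independent_set G I"

definition nested_neighborhoods :: "('a,'b) pre_digraph \<Rightarrow> 'a set \<Rightarrow> bool" where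
  "nested_neighborhoods G U \<longleftrightarrow>
     (\<exists>vs. distinct vs \<and> set vs = U \<and>
        (\<forall>i. Suc i < length vs \<longrightarrow> neighborhood G (vs ! i) \<subseteq> neighborhood G (vs ! Suc i)))"

definition threshold_graph :: "('a,'b) pre_digraph \<Rightarrow> bool" where
  "threshold_graph G \<longleftrightarrow> graph G \<and> (\<exists>K I. KI_split G K I \<and> nested_neighborhoods G I)"

text \<open>
  The library predicate \<^const>\<open>tree\<close> forbids all directed cycles, so a symmetric digraph with an
  edge \<open>{a, b}\<close> never satisfies it, because of the closed walk \<open>a, b, a\<close>. In a simple graph the
  undirected cycles are exactly the directed cycles of length at least 3.
  The library predicate \<^const>\<open>connected\<close> requires at least one vertex.
\<close>

definition undirected_tree :: "('a,'b) pre_digraph \<Rightarrow> bool" where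
  "undirected_tree T \<longleftrightarrow>
     graph T \<and> connected T \<and> \<not> (\<exists>p. pre_digraph.cycle T p \<and> 3 \<le> length p)"

definition subtree :: "('a,'b) pre_digraph \<Rightarrow> ('a,'b) pre_digraph \<Rightarrow> bool" where
  "subtree H T \<longleftrightarrow> subgraph H T \<and> undirected_tree H"

text \<open>
  Chordality of \<open>G\<close> is only the customary scope of the next notion and is not part of it; threshold
  graphs are chordal.
\<close>

definition clique_tree_pair ::
  "('a,'b) pre_digraph \<Rightarrow> ('t,'e) pre_digraph \<Rightarrow> ('t \<Rightarrow> 'a set) \<Rightarrow> bool" where
  "clique_tree_pair G T \<sigma> \<longleftrightarrow>
     undirected_tree T \<and> bij_betw \<sigma> (verts T) (maximal_cliques G) \<and>
     (\<forall>v\<in>verts G. subtree (T \<restriction> {u \<in> verts T. v \<in> \<sigma> u}) T)"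

definition large_maximal_cliques :: "('a,'b) pre_digraph \<Rightarrow> nat \<Rightarrow> 'a set set" where
  "large_maximal_cliques G j = {M \<in> maximal_cliques G. j \<le> card M}"

definition level_subgraph ::
  "('a,'b) pre_digraph \<Rightarrow> ('t,'e) pre_digraph \<Rightarrow> ('t \<Rightarrow> 'a set) \<Rightarrow> nat \<Rightarrow> ('t,'e) pre_digraph" where
  "level_subgraph G T \<sigma> j = T \<restriction> (inv_into (verts T) \<sigma> ` large_maximal_cliques G j)"

end

theory Submission
  imports Defs
begin

text \<open>
  In a threshold graph with partition \<open>K\<close>, \<open>I\<close>, the maximal cliques are the closed neighborhoods of the
  vertices of \<open>I\<close>, together with \<open>K\<close> if no vertex of \<open>I\<close> is adjacent to all of \<open>K\<close>. Because the
  neighborhoods are nested, a vertex of \<open>K\<close> with a neighbor in \<open>I\<close> lies in exactly the maximal cliques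
  whose size is at least some threshold. All other vertices lie in a single maximal clique.
  Conversely, each set of maximal cliques of size at least \<open>j\<close> is the set of all maximal cliques, a
  singleton, or the set of maximal cliques through some vertex. So the two families of node
  sets that are required to be connected differ only by singletons and the full node set, which
  always induce subtrees.
\<close>

section \<open>Subtrees\<close>

lemma undirected_tree_wf_digraph: "undirected_tree T \<Longrightarrow> wf_digraph T"
  by (simp add: undirected_tree_def graph_def digraph_def fin_digraph_def)

lemma subtree_induce_verts:
  assumes "undirected_tree T"
  shows "subtree (T \<restriction> verts T) T"
proof -
  interpret wf_digraph T
    using assms by (rule undirected_tree_wf_digraph)
  have "T \<restriction> verts T = T"
    by (intro pre_digraph.equality) auto
  then show ?thesis
    using assms subgraph_refl by (simp add: subtree_def)
qed

text \<open>Loop-freeness leaves no arcs on a single node, so symmetry and acyclicity hold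
  vacuously.\<close>

lemma subtree_induce_singleton:
  assumes "undirected_tree T" and "x \<in> verts T"
  shows "subtree (T \<restriction> {x}) T"
proof -
  interpret graph T
    using assms(1) by (simp add: undirected_tree_def)
  let ?H = "T \<restriction> {x}"
  have arcs: "arcs ?H = {}"
    using no_loops by fastforce
  have sub: "subgraph ?H T"
    using assms(2) by (intro induced_imp_subgraph induced_induce) auto
  have "digraph ?H"
    using sub by (rule digraph_subgraph)
  moreover have "symmetric ?H"
    unfolding symmetric_def arcs_ends_def arcs by (simp add: sym_def)
  ultimately have "graph ?H"
    by (rule digraph.graphI)
  moreover have "connected ?H"
    by (simp add: connected_conv)
  moreover have "\<not> pre_digraph.cycle ?H p" for p
    unfolding pre_digraph.cycle_def pre_digraph.awalk_def arcs by simp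
  ultimately show ?thesis
    using sub by (simp add: subtree_def undirected_tree_def)
qed

lemma subgraph_induce_mono:
  assumes "wf_digraph T" and "R \<subseteq> S" and "S \<subseteq> verts T"
  shows "subgraph (T \<restriction> R) (T \<restriction> S)"
proof -
  interpret wf_digraph T by fact
  show ?thesis
    using assms(2,3) by (intro subgraphI) (auto simp: compatible_def intro: wellformed_induce_subgraph)
qed

section \<open>Maximal cliques of a threshold graph\<close>

text \<open>The consecutive inclusions add up to monotonicity along the list, so the positions of
  \<open>v\<close> and \<open>w\<close> decide which inclusion holds.\<close>

lemma nested_neighborhoods_chain:
  assumes "nested_neighborhoods G U" and "v \<in> U" and "w \<in> U"
  shows "neighborhood G v \<subseteq> neighborhood G w \<or> neighborhood G w \<subseteq> neighborhood G v"
proof -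
  obtain vs where vs: "set vs = U"
      "\<And>i. Suc i < length vs \<Longrightarrow> neighborhood G (vs ! i) \<subseteq> neighborhood G (vs ! Suc i)"
    using assms(1) by (auto simp: nested_neighborhoods_def)
  have mono: "neighborhood G (vs ! i) \<subseteq> neighborhood G (vs ! j)" if "i \<le> j" "j < length vs" for i j
    using that
  proof (induction j rule: dec_induct)
    case (step n)
    then show ?case using vs(2)[of n] by auto
  qed simp
  obtain i j where "i < length vs" "j < length vs" "v = vs ! i" "w = vs ! j"
    using assms(2,3) vs(1) by (metis in_set_conv_nth)
  then show ?thesis
    using mono[of i j] mono[of j i] by (metis nat_le_linear)
qed

section \<open>Finiteness of cliques and the clique number\<close>

lemma (in fin_digraph) finite_clique: "clique G C \<Longrightarrow> finite C"
  using finite_subset[OF _ finite_verts] by (simp add: clique_def)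

lemma (in fin_digraph) finite_cliques: "finite {C. clique G C}"
  by (rule finite_subset[of _ "Pow (verts G)"]) (auto simp: clique_def)

lemma (in fin_digraph) card_clique_le_clique_number:
  "clique G C \<Longrightarrow> card C \<le> clique_number G"
  unfolding clique_number_def using finite_cliques by (intro Max_ge) auto

lemma (in fin_digraph) ex_maximal_clique_card_eq_clique_number:
  "\<exists>M\<in>maximal_cliques G. card M = clique_number G"
proof -
  \<comment> \<open>The empty clique makes the set under \<open>Max\<close> nonempty, so the clique
    number is attained, even in the null graph.\<close>
  have "clique G {}"
    by (simp add: clique_def)
  then have "clique_number G \<in> card ` {C. clique G C}"
    unfolding clique_number_def using finite_cliques by (intro Max_in) auto
  then obtain M where M: "clique G M" "card M = clique_number G"
    by auto
  have "C = M" if C: "clique G C" "M \<subseteq> C" for C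
    using finite_clique[OF C(1)] C(2) card_clique_le_clique_number[OF C(1)] M(2) card_seteq[of C M]
    by simp
  then show ?thesis
    using M unfolding maximal_cliques_def by blast
qed

text \<open>The null graph is excluded because its only maximal clique is empty.\<close>

lemma maximal_clique_nonempty:
  assumes "M \<in> maximal_cliques G" and "verts G \<noteq> {}"
  shows "M \<noteq> {}"
proof
  assume "M = {}"
  obtain v where "v \<in> verts G"
    using assms(2) by auto
  then have "clique G {v}"
    by (simp add: clique_def)
  then show False
    using assms(1) \<open>M = {}\<close> by (auto simp: maximal_cliques_def)
qed

section \<open>Shape and size of maximal cliques for a fixed split\<close>

locale split_threshold_graph = graph G for G :: "('a, 'b) pre_digraph" +
  fixes K I :: "'a set"
  assumes split: "KI_split G K I"
    and nested: "nested_neighborhoods G I"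
begin

abbreviation N :: "'a \<Rightarrow> 'a set" where
  "N \<equiv> neighborhood G"

lemma verts_eq: "verts G = K \<union> I" and disjoint: "K \<inter> I = {}"
  and clique_K: "clique G K" and independent_I: "independent_set G I"
  using split by (auto simp: KI_split_def)

lemma finite_K: "finite K"
  using finite_verts verts_eq by simp

lemma finite_I: "finite I"
  using finite_verts verts_eq by simp

lemma N_subset_K: "w \<in> I \<Longrightarrow> N w \<subseteq> K"
  using independent_I verts_eq by (auto simp: neighborhood_def independent_set_def)

lemma finite_N: "w \<in> I \<Longrightarrow> finite (N w)"
  using N_subset_K finite_K by (rule finite_subset)

lemma not_in_N: "w \<in> I \<Longrightarrow> w' \<in> I \<Longrightarrow> w' \<notin> N w"
  using N_subset_K disjoint by auto

text \<open>By nestedness the only alternative is \<open>N w \<subseteq> N v\<close>, which the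
  sizes then turn into an equality.\<close>

lemma N_mono_card:
  assumes "v \<in> I" and "w \<in> I" and "card (N v) \<le> card (N w)"
  shows "N v \<subseteq> N w"
  using nested_neighborhoods_chain[OF nested assms(1,2)] card_seteq[OF finite_N[OF assms(1)] _ assms(3)]
  by auto

text \<open>\<open>N w\<close> is part of the clique \<open>K\<close>, and every clique containing
  \<open>w\<close> stays inside the closed neighborhood of \<open>w\<close>.\<close>

lemma closed_neighborhood_maximal:
  assumes "w \<in> I"
  shows "insert w (N w) \<in> maximal_cliques G"
proof -
  have "clique G (insert w (N w))"
    unfolding clique_def
  proof (intro conjI ballI impI)
    show "insert w (N w) \<subseteq> verts G"
      using assms verts_eq by (auto simp: neighborhood_def)
    fix u v assume "u \<in> insert w (N w)" "v \<in> insert w (N w)" "u \<noteq> v"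
    moreover have "u \<rightarrow>\<^bsub>G\<^esub> v" if "u \<in> N w" "v \<in> N w"
      using that \<open>u \<noteq> v\<close> N_subset_K[OF assms] clique_K by (auto simp: clique_def)
    ultimately show "u \<rightarrow>\<^bsub>G\<^esub> v"
      using graph_symmetric by (auto simp: neighborhood_def)
  qed
  moreover have "C = insert w (N w)" if "clique G C" "insert w (N w) \<subseteq> C" for C
    using that by (auto simp: clique_def neighborhood_def)
  ultimately show ?thesis
    unfolding maximal_cliques_def by blast
qed

text \<open>A clique that leaves \<open>K\<close> contains some \<open>w\<close> of
  \<open>I\<close>, hence lies in the clique \<open>insert w (N w)\<close>; maximality forces
  equality.\<close>

lemma maximal_clique_cases:
  assumes "M \<in> maximal_cliques G"
  obtains (K) "M = K" | (closed_neighborhood) w where "w \<in> I" "M = insert w (N w)"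
proof (cases "M \<subseteq> K")
  case True
  then show ?thesis
    using assms clique_K K by (auto simp: maximal_cliques_def)
next
  case False
  have M: "clique G M" "\<And>C. clique G C \<Longrightarrow> M \<subseteq> C \<Longrightarrow> C = M"
    using assms by (auto simp: maximal_cliques_def)
  then obtain w where w: "w \<in> I" "w \<in> M"
    using False verts_eq by (auto simp: clique_def)
  then have "M \<subseteq> insert w (N w)"
    using M(1) by (auto simp: clique_def neighborhood_def)
  moreover have "clique G (insert w (N w))"
    using closed_neighborhood_maximal[OF w(1)] by (simp add: maximal_cliques_def)
  ultimately show ?thesis
    using M(2) w(1) closed_neighborhood by blast
qed

lemma card_closed_neighborhood: "w \<in> I \<Longrightarrow> card (insert w (N w)) = Suc (card (N w))"
  using finite_N not_in_N by simp

text \<open>A vertex of \<open>I\<close> adjacent to all of \<open>K\<close> would extend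
  \<open>K\<close>, so maximality makes the inclusion \<open>N w \<subseteq> K\<close>
  strict.\<close>

lemma card_N_less_card_K:
  assumes "K \<in> maximal_cliques G" and "w \<in> I"
  shows "card (N w) < card K"
proof -
  have "insert w K \<noteq> K"
    using assms(2) disjoint by auto
  moreover have "clique G (insert w (N w))"
    using closed_neighborhood_maximal[OF assms(2)] by (simp add: maximal_cliques_def)
  ultimately have "N w \<noteq> K"
    using assms(1) by (auto simp: maximal_cliques_def)
  then show ?thesis
    using N_subset_K[OF assms(2)] finite_K by (simp add: psubset_card_mono)
qed

section \<open>Maximal cliques through a vertex versus size levels\<close>

text \<open>By nestedness, a vertex of \<open>I\<close> is adjacent to \<open>v\<close> exactly if
  its neighborhood is at least as large as \<open>N w\<close>, and \<open>j\<close> cuts the sizes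
  at the same place. The level is left flexible: one application derives \<open>j\<close> from
  \<open>w\<close>, the other finds \<open>w\<close> and \<open>v\<close> for a given
  \<open>j\<close>.\<close>

lemma maximal_cliques_through_eq_large:
  assumes w: "w \<in> I" and v: "v \<in> N w"
    and min: "\<And>w'. w' \<in> I \<Longrightarrow> v \<in> N w' \<Longrightarrow> card (N w) \<le> card (N w')"
    and j: "\<And>w'. w' \<in> I \<Longrightarrow> j \<le> Suc (card (N w')) \<longleftrightarrow> card (N w) \<le> card (N w')"
  shows "{M \<in> maximal_cliques G. v \<in> M} = large_maximal_cliques G j"
proof -
  have "v \<in> M \<longleftrightarrow> j \<le> card M" if M: "M \<in> maximal_cliques G" for M
    using M
  proof (cases rule: maximal_clique_cases)
    case K
    \<comment> \<open>A maximal \<open>K\<close> falls on the large side too: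
      \<open>j \<le> Suc (card (N w)) \<le> card K\<close>.\<close>
    then have "card (N w) < card K"
      using card_N_less_card_K M w by simp
    moreover have "j \<le> Suc (card (N w))"
      using j w by simp
    ultimately show ?thesis
      using K v w N_subset_K by auto
  next
    case (closed_neighborhood u)
    then have "v \<noteq> u"
      using v w not_in_N by auto
    moreover have "v \<in> N u \<longleftrightarrow> card (N w) \<le> card (N u)"
      using min[OF closed_neighborhood(1)] N_mono_card[OF w closed_neighborhood(1)] v by auto
    ultimately show ?thesis
      using closed_neighborhood card_closed_neighborhood j by auto
  qed
  then show ?thesis
    by (auto simp: large_maximal_cliques_def)
qed

lemma maximal_cliques_through_cases:
  assumes "v \<in> verts G"
  obtains (singleton) M where "{M \<in> maximal_cliques G. v \<in> M} = {M}"
  | (large) j where "j \<in> {1..clique_number G}"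
      "{M \<in> maximal_cliques G. v \<in> M} = large_maximal_cliques G j"
proof (cases "v \<in> I")
  case True
  have "M = insert v (N v)" if "M \<in> maximal_cliques G" "v \<in> M" for M
    using that(1)
  proof (cases rule: maximal_clique_cases)
    case K
    then show ?thesis using True that(2) disjoint by auto
  next
    case (closed_neighborhood w)
    then show ?thesis using True that(2) not_in_N by auto
  qed
  then have "{M \<in> maximal_cliques G. v \<in> M} = {insert v (N v)}"
    using closed_neighborhood_maximal[OF True] by blast
  then show ?thesis by (rule singleton)
next
  case False
  then have vK: "v \<in> K"
    using assms verts_eq by auto
  let ?W = "{w \<in> I. v \<in> N w}"
  show ?thesis
  proof (cases "?W = {}")
    case True
    have "M = K" if "M \<in> maximal_cliques G" "v \<in> M" for M
      using that(1)
    proof (cases rule: maximal_clique_cases)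
      case (closed_neighborhood w)
      then show ?thesis using True that(2) False by blast
    qed
    moreover have "K \<in> maximal_cliques G"
    proof -
      \<comment> \<open>A clique properly containing \<open>K\<close> has a vertex \<open>c\<close>
        of \<open>I\<close>, which would be a neighbor of \<open>v\<close> in
        \<open>I\<close>.\<close>
      have "C = K" if C: "clique G C" "K \<subseteq> C" for C
      proof (rule ccontr)
        assume "C \<noteq> K"
        then obtain c where c: "c \<in> C" "c \<in> I"
          using C verts_eq unfolding clique_def by blast
        then have "c \<noteq> v" "v \<in> C"
          using C(2) vK False by auto
        then have "c \<rightarrow>\<^bsub>G\<^esub> v"
          using C(1) c(1) by (simp add: clique_def)
        then have "v \<in> N c"
          using assms by (simp add: neighborhood_def)
        then show False
          using True c(2) by auto
      qed
      then show ?thesis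
        using clique_K unfolding maximal_cliques_def by blast
    qed
    ultimately have "{M \<in> maximal_cliques G. v \<in> M} = {K}"
      using vK by blast
    then show ?thesis by (rule singleton)
  next
    case nonempty: False
    have "finite ?W"
      using finite_I by simp
    then obtain w where w: "w \<in> ?W" "\<And>w'. w' \<in> ?W \<Longrightarrow> card (N w) \<le> card (N w')"
      using nonempty arg_min_if_finite(1)[of ?W "\<lambda>w. card (N w)"]
        arg_min_least[of ?W _ "\<lambda>w. card (N w)"] by blast
    \<comment> \<open>The size of the closed neighborhood of \<open>w\<close>, which is the least
      size of a maximal clique through \<open>v\<close>.\<close>
    let ?j = "Suc (card (N w))"
    have "{M \<in> maximal_cliques G. v \<in> M} = large_maximal_cliques G ?j"
      using w by (intro maximal_cliques_through_eq_large[of w]) auto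
    moreover have "clique G (insert w (N w))"
      using closed_neighborhood_maximal w(1) by (simp add: maximal_cliques_def)
    then have "?j \<in> {1..clique_number G}"
      using card_clique_le_clique_number[of "insert w (N w)"] card_closed_neighborhood w(1) by simp
    ultimately show ?thesis
      using large by blast
  qed
qed

text \<open>Level 1 contains everything. If no closed neighborhood of a vertex of \<open>I\<close>
  reaches size \<open>j\<close>, only \<open>K\<close> can remain. Otherwise some \<open>v\<close>
  lies in all neighborhoods above the cut and in none below it.\<close>

lemma large_maximal_cliques_cases:
  assumes j: "j \<in> {1..clique_number G}"
  obtains (all) "large_maximal_cliques G j = maximal_cliques G"
  | (singleton) M where "large_maximal_cliques G j = {M}"
  | (through) v where "v \<in> verts G" "large_maximal_cliques G j = {M \<in> maximal_cliques G. v \<in> M}"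
proof -
  obtain M0 where M0: "M0 \<in> maximal_cliques G" "card M0 = clique_number G"
    using ex_maximal_clique_card_eq_clique_number by auto
  let ?W = "{w \<in> I. j \<le> Suc (card (N w))}"
  consider "j = 1" | "?W = {}" | "j > 1" "?W \<noteq> {}"
    using j by fastforce
  then show ?thesis
  proof cases
    case 1
    have "verts G \<noteq> {}"
      using M0 j by (auto simp: maximal_cliques_def clique_def)
    then have "card M \<ge> 1" if "M \<in> maximal_cliques G" for M
      using that maximal_clique_nonempty[of M G] finite_clique[of M]
      by (simp add: Suc_le_eq card_gt_0_iff maximal_cliques_def)
    then show ?thesis
      using 1 all by (auto simp: large_maximal_cliques_def)
  next
    case 2
    have "M = K" if "M \<in> large_maximal_cliques G j" for M
    proof -
      have M: "M \<in> maximal_cliques G" "j \<le> card M"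
        using that by (auto simp: large_maximal_cliques_def)
      from M(1) show ?thesis
      proof (cases rule: maximal_clique_cases)
        case (closed_neighborhood w)
        then show ?thesis
          using 2 M(2) card_closed_neighborhood by auto
      qed
    qed
    \<comment> \<open>\<open>M0\<close> shows that the level is nonempty, so \<open>K\<close> really
      occurs in it.\<close>
    moreover have "M0 \<in> large_maximal_cliques G j"
      using M0 j by (simp add: large_maximal_cliques_def)
    ultimately have "large_maximal_cliques G j = {K}"
      by blast
    then show ?thesis by (rule singleton)
  next
    case 3
    have "finite ?W"
      using finite_I by simp
    then obtain w where w: "w \<in> ?W" "\<And>w'. w' \<in> ?W \<Longrightarrow> card (N w) \<le> card (N w')"
      using 3(2) arg_min_if_finite(1)[of ?W "\<lambda>w. card (N w)"]
        arg_min_least[of ?W _ "\<lambda>w. card (N w)"] by blast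
    have "\<exists>v\<in>N w. \<forall>w'\<in>I - ?W. v \<notin> N w'"
    proof (cases "I - ?W = {}")
      case True
      \<comment> \<open>With nothing below the cut, any element of \<open>N w\<close> serves;
        \<open>j > 1\<close> supplies one, whereas at level 1 the vertex \<open>w\<close> could be
        isolated.\<close>
      have "N w \<noteq> {}"
        using w(1) 3(1) by auto
      then show ?thesis
        using True by blast
    next
      case False
      \<comment> \<open>\<open>A\<close> collects the vertices below the cut. Its largest
        neighborhood \<open>N u\<close> contains the others and is smaller than \<open>N w\<close>,
        so some \<open>v\<close> in \<open>N w\<close> avoids them all.\<close>
      define A where "A = I - ?W"
      have A: "finite A" "A \<noteq> {}"
        using finite_I False by (auto simp: A_def)
      obtain u where u: "u \<in> A" "Max ((\<lambda>w. card (N w)) ` A) = card (N u)"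
        using obtains_MAX[OF A] by blast
      have u_max: "card (N w') \<le> card (N u)" if "w' \<in> A" for w'
        using Max_ge[of "(\<lambda>w. card (N w)) ` A" "card (N w')"] A(1) that u(2) by simp
      have "card (N u) < card (N w)"
        using u(1) w(1) by (auto simp: A_def)
      then obtain v where v: "v \<in> N w" "v \<notin> N u"
        using u(1) finite_N[of u] card_mono[of "N u" "N w"] by (auto simp: A_def)
      have "v \<notin> N w'" if "w' \<in> A" for w'
        using N_mono_card[of w' u] u_max[OF that] u(1) that v(2) by (auto simp: A_def)
      then show ?thesis
        using v(1) by (auto simp: A_def)
    qed
    then obtain v where v: "v \<in> N w" "\<And>w'. w' \<in> I - ?W \<Longrightarrow> v \<notin> N w'"
      by blast
    have "{M \<in> maximal_cliques G. v \<in> M} = large_maximal_cliques G j"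
    proof (rule maximal_cliques_through_eq_large)
      show "w \<in> I" "v \<in> N w"
        using w(1) v(1) by auto
      show "card (N w) \<le> card (N w')" if "w' \<in> I" "v \<in> N w'" for w'
        using that v(2) w(2) by blast
      show "j \<le> Suc (card (N w')) \<longleftrightarrow> card (N w) \<le> card (N w')" if "w' \<in> I" for w'
        using that w by force
    qed
    moreover have "v \<in> verts G"
      using v(1) by (simp add: neighborhood_def)
    ultimately show ?thesis
      using through by simp
  qed
qed

end

section \<open>Clique trees of threshold graphs\<close>

text \<open>The predicate \<open>P\<close> is kept abstract to serve both for containing a given
  vertex and for having size at least \<open>j\<close>.\<close>

lemma subtree_induce_preimage_singleton:
  assumes "undirected_tree T" and "bij_betw \<sigma> (verts T) A" and "{M \<in> A. P M} = {M}"
  shows "subtree (T \<restriction> {u \<in> verts T. P (\<sigma> u)}) T"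
proof -
  have "M \<in> A"
    using assms(3) by blast
  then obtain x where x: "x \<in> verts T" "\<sigma> x = M"
    using assms(2) by (auto simp: bij_betw_def)
  have "{u \<in> verts T. P (\<sigma> u)} = {x}"
    using x assms(2,3) by (auto simp: bij_betw_def inj_on_def)
  then show ?thesis
    using subtree_induce_singleton[OF assms(1) x(1)] by simp
qed

text \<open>Injectivity of \<open>\<sigma>\<close> removes the inverse, so that levels and node sets
  of vertices are both comprehensions over \<open>verts T\<close>.\<close>

lemma level_subgraph_eq:
  assumes "bij_betw \<sigma> (verts T) (maximal_cliques G)"
  shows "level_subgraph G T \<sigma> j = T \<restriction> {u \<in> verts T. j \<le> card (\<sigma> u)}"
proof -
  have inj: "inj_on \<sigma> (verts T)" and image: "maximal_cliques G = \<sigma> ` verts T"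
    using assms by (auto simp: bij_betw_def)
  have "large_maximal_cliques G j = \<sigma> ` {u \<in> verts T. j \<le> card (\<sigma> u)}"
    unfolding large_maximal_cliques_def image by auto
  then show ?thesis
    by (simp add: level_subgraph_def inv_into_image_cancel[OF inj])
qed

theorem theorem5p2:
  fixes G :: "('a,'b) pre_digraph"
    and T :: "('t,'e) pre_digraph"
    and \<sigma> :: "'t \<Rightarrow> 'a set"
  assumes "threshold_graph G"
    and "undirected_tree T"
    and "bij_betw \<sigma> (verts T) (maximal_cliques G)"
  shows "clique_tree_pair G T \<sigma> \<longleftrightarrow>
    (\<forall>j\<in>{1..clique_number G}. subtree (level_subgraph G T \<sigma> j) T) \<and>
    (\<forall>j\<in>{1..clique_number G - 1}.
       subtree (level_subgraph G T \<sigma> (j + 1)) (level_subgraph G T \<sigma> j))"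
proof -
  obtain K I where "split_threshold_graph G K I"
    using assms(1)
    by (auto simp: threshold_graph_def split_threshold_graph_def split_threshold_graph_axioms_def)
  then interpret split_threshold_graph G K I .
  note level = level_subgraph_eq[OF assms(3)]
  have \<sigma>: "\<sigma> u \<in> maximal_cliques G" if "u \<in> verts T" for u
    using assms(3) that by (auto simp: bij_betw_def)
  have ctp: "clique_tree_pair G T \<sigma> \<longleftrightarrow> (\<forall>v\<in>verts G. subtree (T \<restriction> {u \<in> verts T. v \<in> \<sigma> u}) T)"
    using assms(2,3) by (simp add: clique_tree_pair_def)
  have through_eq_level: "T \<restriction> {u \<in> verts T. v \<in> \<sigma> u} = level_subgraph G T \<sigma> j"
    if "{M \<in> maximal_cliques G. v \<in> M} = large_maximal_cliques G j" for v j
  proof -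
    have "{u \<in> verts T. v \<in> \<sigma> u} = {u \<in> verts T. j \<le> card (\<sigma> u)}"
      using that \<sigma> by (auto simp: large_maximal_cliques_def)
    then show ?thesis
      by (simp add: level)
  qed
  show ?thesis
  proof (intro iffI conjI ballI)
    assume "clique_tree_pair G T \<sigma>"
    then have through_subtree: "subtree (T \<restriction> {u \<in> verts T. v \<in> \<sigma> u}) T" if "v \<in> verts G" for v
      using that ctp by simp
    show level_subtree: "subtree (level_subgraph G T \<sigma> j) T" if "j \<in> {1..clique_number G}" for j
      using that
    proof (cases rule: large_maximal_cliques_cases)
      case all
      then have "{u \<in> verts T. j \<le> card (\<sigma> u)} = verts T"
        using \<sigma> by (auto simp: large_maximal_cliques_def)
      then show ?thesis
        using subtree_induce_verts[OF assms(2)] by (simp add: level)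
    next
      case (singleton M)
      then show ?thesis
        using subtree_induce_preimage_singleton[OF assms(2,3), of "\<lambda>M. j \<le> card M"]
        by (simp add: level large_maximal_cliques_def)
    next
      case (through v)
      then show ?thesis
        using through_subtree[of v] through_eq_level[of v j] by simp
    qed
    show "subtree (level_subgraph G T \<sigma> (j + 1)) (level_subgraph G T \<sigma> j)"
      if "j \<in> {1..clique_number G - 1}" for j
    proof -
      \<comment> \<open>The node sets shrink as the size bound grows. The tree property comes from
        the first family, since \<open>j \<ge> 1\<close> and
        \<open>j \<le> clique_number G - 1\<close> give \<open>j + 1 \<le> clique_number G\<close>
        even with truncated subtraction.\<close>
      have "subgraph (level_subgraph G T \<sigma> (j + 1)) (level_subgraph G T \<sigma> j)"
        unfolding level
        using undirected_tree_wf_digraph[OF assms(2)] by (intro subgraph_induce_mono) auto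
      then show ?thesis
        using level_subtree[of "j + 1"] that by (auto simp: subtree_def)
    qed
  next
    assume levels: "(\<forall>j\<in>{1..clique_number G}. subtree (level_subgraph G T \<sigma> j) T) \<and>
      (\<forall>j\<in>{1..clique_number G - 1}.
         subtree (level_subgraph G T \<sigma> (j + 1)) (level_subgraph G T \<sigma> j))"
    have "subtree (T \<restriction> {u \<in> verts T. v \<in> \<sigma> u}) T" if "v \<in> verts G" for v
      using that
    proof (cases rule: maximal_cliques_through_cases)
      case (singleton M)
      then show ?thesis
        by (rule subtree_induce_preimage_singleton[OF assms(2,3)])
    next
      case (large j)
      then show ?thesis
        using levels through_eq_level by simp
    qed
    then show "clique_tree_pair G T \<sigma>"
      by (simp add: ctp)
  qed
qed

end
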